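(* For every integer $m$ and every positive integer $n$, \[ \sum_{j=1}^n\binom{n}{j}\Big\lfloor\frac{j}{2}\Big\rfloor F_{3j+m}=2^{n-2}\big(nF_{2n+m+1}-F_{2n+m}+(-1)^nF_{n+m}\big) \] and \[ \sum_{j=1}^n\binom{n}{j}\Big\lfloor\frac{j}{2}\Big\rfloor L_{3j+m}=2^{n-2}\big(nL_{2n+m+1}-L_{2n+m}+(-1)^nL_{n+m}\big). \]
   Context: $F_n$ and $L_n$ are the Fibonacci and Lucas numbers, defined for all integers $n$ by $F_n=(\alpha^n-\beta^n)/\sqrt5$, $L_n=\alpha^n+\beta^n$ with $\alpha=(1+\sqrt5)/2$, $\beta=(1-\sqrt5)/2$. $\lfloor x\rfloor$ is the floor function. *)

theory Defs
  imports Complex_Main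
begin

definition gold_alpha :: real where
  "gold_alpha = (1 + sqrt 5) / 2"

definition gold_beta :: real where
  "gold_beta = (1 - sqrt 5) / 2"

(* Real-valued, at all integer indices; powi is the power with integer exponent. *)

definition fibZ :: "int \<Rightarrow> real" where
  "fibZ n = (gold_alpha powi n - gold_beta powi n) / sqrt 5"

definition lucasZ :: "int \<Rightarrow> real" where
  "lucasZ n = gold_alpha powi n + gold_beta powi n"

end

(* Since floor(j/2) = (2j - 1 + (-1)^j)/4, the sum over j of C(n,j) floor(j/2) x^j is evaluated by the
   binomial theorem at x and -x and by its derivative.  For a root a of a^2 = a + 1 and x = a^3 the
   bases collapse to 1 + x = 2 a^2 and 1 - x = -2 a.  Both identities are linear combinations of
   the resulting one for a = alpha and a = beta. *)

theory Submission
  imports Defs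
begin

text \<open>Absorption, (k+1) C(p+1,k+1) = (p+1) C(p,k), lowers both indices and leaves the binomial
  theorem for exponent p. This is x times the derivative of that theorem, obtained without calculus
  and hence over any commutative ring. At n = 0 the truncated exponent \<open>n - 1\<close> is
  harmless because the factor \<open>of_nat n\<close> vanishes.\<close>

lemma sum_binomial_times_index:
  fixes x :: "'a::comm_ring_1"
  shows "(\<Sum>k\<le>n. of_nat (n choose k) * of_nat k * x ^ k) = of_nat n * x * (1 + x) ^ (n - 1)"
proof (cases n)
  case (Suc p)
  have "of_nat (Suc p choose Suc k) * of_nat (Suc k) * x ^ Suc k
      = of_nat (Suc p) * x * (of_nat (p choose k) * x ^ k)" for k
  proof -
    have "of_nat (Suc p choose Suc k) * of_nat (Suc k) = (of_nat (Suc p) * of_nat (p choose k) :: 'a)"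
      by (metis Suc_times_binomial_eq mult.commute of_nat_mult)
    then show ?thesis by (simp only: power_Suc mult_ac)
  qed
  \<comment> \<open>The shift is lossless: the term at k = 0 carries the factor 0.\<close>
  then have "(\<Sum>k\<le>Suc p. of_nat (Suc p choose k) * of_nat k * x ^ k)
      = of_nat (Suc p) * x * (\<Sum>k\<le>p. of_nat (p choose k) * x ^ k)"
    by (simp only: sum.atMost_Suc_shift sum_distrib_left) simp
  also have "(\<Sum>k\<le>p. of_nat (p choose k) * x ^ k) = (1 + x) ^ p"
    using binomial_ring[of x 1 p] by (simp add: add.commute)
  finally show ?thesis using Suc by simp
qed simp

lemma of_int_floor_half:
  "of_int \<lfloor>real j / 2\<rfloor> = (2 * real j - 1 + (-1) ^ j) / 4"
proof (cases "even j")
  case True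
  then show ?thesis by (auto elim!: evenE)
next
  case False
  then obtain k where k: "j = 2 * k + 1" by (elim oddE)
  have "\<lfloor>real j / 2\<rfloor> = int k" unfolding k by (simp add: floor_eq_iff)
  then show ?thesis by (simp add: k)
qed

lemma sum_binomial_floor_half:
  fixes x :: real
  shows "(\<Sum>j\<le>n. real (n choose j) * of_int \<lfloor>real j / 2\<rfloor> * x ^ j)
    = (2 * real n * x * (1 + x) ^ (n - 1) - (1 + x) ^ n + (1 - x) ^ n) / 4"
proof -
  \<comment> \<open>The parity sign is absorbed into the power, (-1)^j x^j = (-x)^j, so the last of
    the three sums is again a binomial sum.\<close>
  have "(\<Sum>j\<le>n. real (n choose j) * of_int \<lfloor>real j / 2\<rfloor> * x ^ j)
    = (2 * (\<Sum>j\<le>n. real (n choose j) * real j * x ^ j)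
       - (\<Sum>j\<le>n. real (n choose j) * x ^ j) + (\<Sum>j\<le>n. real (n choose j) * (- x) ^ j)) / 4"
    unfolding of_int_floor_half sum_distrib_left sum_subtractf[symmetric] sum.distrib[symmetric]
      sum_divide_distrib
    by (intro sum.cong refl) (simp add: power_minus[of x] field_simps)
  also have "(\<Sum>j\<le>n. real (n choose j) * x ^ j) = (1 + x) ^ n"
    using binomial_ring[of x 1 n] by (simp add: add.commute)
  also have "(\<Sum>j\<le>n. real (n choose j) * (- x) ^ j) = (1 - x) ^ n"
    using binomial_ring[of "- x" 1 n] by simp
  finally show ?thesis unfolding sum_binomial_times_index by (simp only: mult.assoc)
qed

lemma sum_binomial_floor_half_golden:
  fixes a :: real
  assumes a: "a\<^sup>2 = a + 1"
  shows "(\<Sum>j=1..n. real (n choose j) * of_int \<lfloor>real j / 2\<rfloor> * a powi (3 * int j + m))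
    = 2 powi (int n - 2) *
      (real n * a powi (2 * int n + m + 1) - a powi (2 * int n + m) + (-1) ^ n * a powi (int n + m))"
proof -
  \<comment> \<open>Since \<open>m\<close> may be negative, splitting off the factor
    \<open>a powi m\<close> calls for a nonzero base.\<close>
  have a0: "a \<noteq> 0" using a by auto
  have powi: "a powi (int k + m) = a ^ k * a powi m" for k
    using a0 by (simp add: power_int_add)
  have p3: "a powi (3 * int j + m) = (a ^ 3) ^ j * a powi m" for j
    using powi[of "3 * j"] by (simp add: power_mult)
  have p2: "a powi (2 * int n + m) = a ^ (2 * n) * a powi m"
    using powi[of "2 * n"] by simp
  have p21: "a powi (2 * int n + m + 1) = a ^ (2 * n + 1) * a powi m"
    using powi[of "2 * n + 1"] by (simp add: algebra_simps)
  \<comment> \<open>The 4 will match the denominator in the formula for the floor; an integer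
    exponent is used because n - 2 is negative at n = 1.\<close>
  have two: "(2::real) powi (int n - 2) = 2 ^ n / 4"
    by (simp add: power_int_diff)
  have cube: "a ^ 3 = 2 * a + 1"
    using a by (simp add: power3_eq_cube power2_eq_square algebra_simps)
  have plus: "1 + a ^ 3 = 2 * a\<^sup>2" and minus: "1 - a ^ 3 = - 2 * a"
    using a cube by simp_all
  \<comment> \<open>For n = p + 1 the powers of a add up as 3 + 2p = 2n + 1, and the powers of 2 as
    1 + p = n.\<close>
  have deriv: "2 * real n * a ^ 3 * (1 + a ^ 3) ^ (n - 1) = 2 ^ n * (real n * a ^ (2 * n + 1))"
  proof (cases n)
    case (Suc p)
    then show ?thesis
      unfolding plus by (simp add: power_mult_distrib power_mult[symmetric] power_add[symmetric]
          power3_eq_cube mult_ac)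
  qed simp
  have "(\<Sum>j=1..n. real (n choose j) * of_int \<lfloor>real j / 2\<rfloor> * a powi (3 * int j + m))
      = (\<Sum>j\<le>n. real (n choose j) * of_int \<lfloor>real j / 2\<rfloor> * a powi (3 * int j + m))"
    \<comment> \<open>The only added index is j = 0, where the floor is 0.\<close>
    by (rule sum.mono_neutral_left) (auto simp: not_le)
  also have "\<dots> = (\<Sum>j\<le>n. real (n choose j) * of_int \<lfloor>real j / 2\<rfloor> * (a ^ 3) ^ j) * a powi m"
    unfolding p3 sum_distrib_right by (simp only: mult.assoc)
  also have "\<dots> = (2 ^ n * (real n * a ^ (2 * n + 1)) - (2 * a\<^sup>2) ^ n + (- 2 * a) ^ n) / 4 * a powi m"
    unfolding sum_binomial_floor_half deriv unfolding plus minus ..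
  also have "(2 * a\<^sup>2) ^ n = 2 ^ n * a ^ (2 * n)"
    by (simp add: power_mult_distrib power_mult)
  also have "(- 2 * a) ^ n = 2 ^ n * ((-1) ^ n * a ^ n)"
    by (simp add: power_mult_distrib power_minus[of "2 * a"])
  finally show ?thesis
    unfolding p2 p21 powi two by (simp add: algebra_simps)
qed

lemma gold_alpha_square: "gold_alpha\<^sup>2 = gold_alpha + 1"
  by (simp add: gold_alpha_def power2_eq_square field_simps)

lemma gold_beta_square: "gold_beta\<^sup>2 = gold_beta + 1"
  by (simp add: gold_beta_def power2_eq_square field_simps)

theorem theorem18:
  fixes m :: int and n :: nat
  assumes "n \<ge> 1"
  shows "((\<Sum>j=1..n. real (n choose j) * of_int \<lfloor>real j / 2\<rfloor> * fibZ (3 * int j + m))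
      = 2 powi (int n - 2) *
        (real n * fibZ (2 * int n + m + 1) - fibZ (2 * int n + m) + (-1) ^ n * fibZ (int n + m)))
    \<and> ((\<Sum>j=1..n. real (n choose j) * of_int \<lfloor>real j / 2\<rfloor> * lucasZ (3 * int j + m))
      = 2 powi (int n - 2) *
        (real n * lucasZ (2 * int n + m + 1) - lucasZ (2 * int n + m) + (-1) ^ n * lucasZ (int n + m)))"
proof -
  define S where "S a = (\<Sum>j=1..n. real (n choose j) * of_int \<lfloor>real j / 2\<rfloor> * a powi (3 * int j + m))"
    for a :: real
  note S = sum_binomial_floor_half_golden[OF gold_alpha_square, of n m, folded S_def]
    sum_binomial_floor_half_golden[OF gold_beta_square, of n m, folded S_def]
  have fib: "(\<Sum>j=1..n. real (n choose j) * of_int \<lfloor>real j / 2\<rfloor> * fibZ (3 * int j + m))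
      = (S gold_alpha - S gold_beta) / sqrt 5"
    unfolding S_def fibZ_def sum_subtractf[symmetric] sum_divide_distrib
    by (simp only: right_diff_distrib times_divide_eq_right)
  have lucas: "(\<Sum>j=1..n. real (n choose j) * of_int \<lfloor>real j / 2\<rfloor> * lucasZ (3 * int j + m))
      = S gold_alpha + S gold_beta"
    unfolding S_def lucasZ_def sum.distrib[symmetric] by (simp only: distrib_left)
  \<comment> \<open>The closed form is linear in the powers of the base too, so combining its values
    at the two roots as in Binet's formulas turns those powers into \<open>fibZ\<close> and
    \<open>lucasZ\<close>.\<close>
  show ?thesis
    unfolding fib lucas S unfolding fibZ_def lucasZ_def
    by (simp add: algebra_simps add_divide_distrib diff_divide_distrib)
qed

end
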